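(* Let $n\in\mathbb{N}$ and let $F:\mathbb{R}^n\to\mathbb{R}$ be a polynomial with real coefficients, $F(x)=\sum_{\ell}\alpha_\ell x^\ell$ (finite sum), where $\ell=(\ell_1,\dots,\ell_n)$ ranges over multi-indices of non-negative integers and $x^\ell=\prod_{i=1}^n x_i^{\ell_i}$. Assume that there exists a multi-index $\ell$ with $|\ell|>0$ and $\alpha_\ell\notin\mathbb{Q}$. Then $F(\mathbb{Z}^n)\bmod 1$ is equidistributed.
   Context: $\mathbb{N}=\{1,2,\dots\}$; $|\ell|=\ell_1+\dots+\ell_n$ for a multi-index $\ell$. Equidistribution: let $\Gamma\subset\mathbb{R}^n$ be a discrete set and $F:D\to\mathbb{R}$ with $D\subset\mathbb{R}^n$. Let $B_R(0)$ be the Euclidean ball of radius $R$ around the origin, and let $\sigma_R^D$ be the normalized counting measure (uniform probability measure) on the finite set $\Gamma\cap B_R(0)\cap D$, defined for all $R$ large enough that this set is nonempty. Let $F\bmod 1:D\to\mathbb{R}/\mathbb{Z}$ be the composition of $F$ with the quotient map, and identify $\mathbb{R}/\mathbb{Z}$ with the unit circle $S^1$ via $t\mapsto e^{2\pi i t}$. One says that $F(\Gamma)\bmod 1$ is equidistributed if the push-forward measures $(F\bmod 1)_*\sigma_R^D$ converge weakly, as $R\to\infty$, to the Haar probability measure $\lambda$ on $S^1$. In this statement $D=\mathbb{R}^n$ and $\Gamma=\mathbb{Z}^n$. *)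

theory Defs
  imports "HOL-Probability.Probability"
begin

section \<open>The unit circle and its Haar probability measure\<close>

abbreviation unit_circle :: "complex set"
  where "unit_circle \<equiv> sphere 0 1"

abbreviation circle_borel :: "complex measure"
  where "circle_borel \<equiv> restrict_space borel unit_circle"

text \<open>
  The image of the uniform distribution on \<open>[0, 1)\<close> under \<open>t \<mapsto> exp (2 \<pi> i t)\<close>.
  Theorem \<open>is_haar_prob_circle_iff\<close> below shows that this is the Haar probability measure, i.e.
  the only rotation-invariant Borel probability measure on the circle.
\<close>
definition haar_circle :: "complex measure"
  where "haar_circle =
    distr (uniform_measure lborel {0..<1::real}) circle_borel (\<lambda>t. cis (2 * pi * t))"

definition is_haar_prob_circle :: "complex measure \<Rightarrow> bool"
  where "is_haar_prob_circle \<mu> \<longleftrightarrow>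
    sets \<mu> = sets circle_borel \<and> prob_space \<mu> \<and>
    (\<forall>w\<in>unit_circle. distr \<mu> circle_borel (\<lambda>z. w * z) = \<mu>)"

lemma measurable_cis_circle [measurable]:
  "(\<lambda>t. cis (2 * pi * t)) \<in> borel \<rightarrow>\<^sub>M circle_borel"
  by (intro measurable_restrict_space2)
     (auto intro!: borel_measurable_continuous_onI continuous_intros)

lemma measurable_mult_circle:
  "(\<lambda>p. fst p * snd p) \<in> circle_borel \<Otimes>\<^sub>M circle_borel \<rightarrow>\<^sub>M circle_borel"
proof (rule measurable_restrict_space2)
  have [measurable]: "(\<lambda>z. z) \<in> circle_borel \<rightarrow>\<^sub>M borel"
    by (rule measurable_restrict_space1) simp
  have [measurable]: "fst \<in> circle_borel \<Otimes>\<^sub>M circle_borel \<rightarrow>\<^sub>M borel"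
    by (rule measurable_compose[OF measurable_fst]) measurable
  have [measurable]: "snd \<in> circle_borel \<Otimes>\<^sub>M circle_borel \<rightarrow>\<^sub>M borel"
    by (rule measurable_compose[OF measurable_snd]) measurable
  show "(\<lambda>p. fst p * snd p) \<in> circle_borel \<Otimes>\<^sub>M circle_borel \<rightarrow>\<^sub>M borel"
    by measurable
qed (auto simp: space_pair_measure space_restrict_space norm_mult)

lemma measurable_rotate_circle:
  assumes "w \<in> unit_circle"
  shows "(\<lambda>z. w * z) \<in> circle_borel \<rightarrow>\<^sub>M circle_borel"
proof -
  have "(\<lambda>z. (w, z)) \<in> circle_borel \<rightarrow>\<^sub>M circle_borel \<Otimes>\<^sub>M circle_borel"
    using assms by (intro measurable_Pair) (auto simp: space_restrict_space)
  from measurable_compose[OF this measurable_mult_circle] show ?thesis by simp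
qed

lemma nn_integral_periodic_shift:
  fixes g :: "real \<Rightarrow> ennreal"
  assumes [measurable]: "g \<in> borel_measurable borel"
    and per: "\<And>t. g (t + 1) = g t" and s: "0 \<le> s" "s < 1"
  shows "(\<integral>\<^sup>+t. g (s + t) * indicator {0..<1} t \<partial>lborel) =
         (\<integral>\<^sup>+t. g t * indicator {0..<1} t \<partial>lborel)"
proof -
  have "(\<integral>\<^sup>+t. g (s + t) * indicator {0..<1} t \<partial>lborel) =
        (\<integral>\<^sup>+t. g t * indicator {0..<1} (t - s) \<partial>lborel)"
    by (subst nn_integral_real_affine[where c = 1 and t = s]) (auto simp: one_ennreal_def[symmetric])
  also have "\<dots> = (\<integral>\<^sup>+t. g t * indicator {s..<1} t + g t * indicator {1..<1+s} t \<partial>lborel)"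
    using s by (intro nn_integral_cong) (auto simp: indicator_def)
  also have "\<dots> = (\<integral>\<^sup>+t. g t * indicator {s..<1} t \<partial>lborel) +
                   (\<integral>\<^sup>+t. g t * indicator {1..<1+s} t \<partial>lborel)"
    by (rule nn_integral_add) auto
  also have "(\<integral>\<^sup>+t. g t * indicator {1..<1+s} t \<partial>lborel) =
             (\<integral>\<^sup>+t. g t * indicator {0..<s} t \<partial>lborel)"
    by (subst nn_integral_real_affine[where c = 1 and t = 1])
       (auto simp: one_ennreal_def[symmetric] per add.commute[of 1] indicator_def
             intro!: nn_integral_cong)
  also have "(\<integral>\<^sup>+t. g t * indicator {s..<1} t \<partial>lborel) +
             (\<integral>\<^sup>+t. g t * indicator {0..<s} t \<partial>lborel) =
             (\<integral>\<^sup>+t. g t * indicator {s..<1} t + g t * indicator {0..<s} t \<partial>lborel)"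
    by (rule nn_integral_add[symmetric]) auto
  also have "\<dots> = (\<integral>\<^sup>+t. g t * indicator {0..<1} t \<partial>lborel)"
    using s by (intro nn_integral_cong) (auto simp: indicator_def)
  finally show ?thesis .
qed

lemma sets_haar_circle [simp]: "sets haar_circle = sets circle_borel"
  by (simp add: haar_circle_def)

lemma prob_space_haar_circle: "prob_space haar_circle"
  unfolding haar_circle_def
  by (intro prob_space.prob_space_distr prob_space_uniform_measure) auto

lemma nn_integral_haar_circle:
  assumes [measurable]: "f \<in> borel_measurable circle_borel"
  shows "(\<integral>\<^sup>+z. f z \<partial>haar_circle) =
         (\<integral>\<^sup>+t. f (cis (2 * pi * t)) * indicator {0..<1} t \<partial>lborel)"
proof -
  have [measurable]: "(\<lambda>t. f (cis (2 * pi * t))) \<in> borel_measurable borel"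
    by (rule measurable_compose[OF measurable_cis_circle]) fact
  show ?thesis
    by (simp add: haar_circle_def nn_integral_distr nn_integral_uniform_measure divide_ennreal_def)
qed

lemma haar_circle_rotate:
  assumes w: "w \<in> unit_circle"
  shows "distr haar_circle circle_borel (\<lambda>z. w * z) = haar_circle"
proof (rule measure_eqI)
  fix A assume "A \<in> sets (distr haar_circle circle_borel (\<lambda>z. w * z))"
  hence A [measurable]: "A \<in> sets circle_borel" by simp
  note [measurable] = measurable_rotate_circle[OF w]
  obtain s where s: "0 \<le> s" "s < 1" "w = cis (2 * pi * s)"
  proof -
    obtain r where r: "w = cis r" using w by (metis mem_sphere_0 complex_norm_eq_1_exp cis_conv_exp)
    let ?s = "frac (r / (2 * pi))"
    have "cis (2 * pi * ?s) = cis r * cis (- (2 * pi * of_int \<lfloor>r / (2 * pi)\<rfloor>))"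
      by (simp add: frac_def cis_mult algebra_simps)
    also have "cis (- (2 * pi * of_int \<lfloor>r / (2 * pi)\<rfloor>)) = 1"
      using cis_multiple_2pi[of "- of_int \<lfloor>r / (2 * pi)\<rfloor>"] by simp
    finally show ?thesis using r that[of ?s] by (simp add: frac_lt_1)
  qed
  have mh: "measurable haar_circle N = measurable circle_borel N" for N :: "complex measure"
    by (rule measurable_cong_sets) auto
  have ind: "(indicator A :: complex \<Rightarrow> ennreal) \<in> borel_measurable circle_borel" by measurable
  have ind': "(\<lambda>z. indicator A (w * z) :: ennreal) \<in> borel_measurable circle_borel" by measurable
  have "emeasure (distr haar_circle circle_borel (\<lambda>z. w * z)) A =
        (\<integral>\<^sup>+z. indicator A z \<partial>distr haar_circle circle_borel (\<lambda>z. w * z))"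
    by (subst nn_integral_indicator) auto
  also have "\<dots> = (\<integral>\<^sup>+z. indicator A (w * z) \<partial>haar_circle)"
    using ind by (subst nn_integral_distr) (auto simp: mh)
  also have "\<dots> = (\<integral>\<^sup>+t. indicator A (w * cis (2 * pi * t)) * indicator {0..<1} t \<partial>lborel)"
    by (rule nn_integral_haar_circle[OF ind'])
  also have "\<dots> = (\<integral>\<^sup>+t. indicator A (cis (2 * pi * (s + t))) * indicator {0..<1} t \<partial>lborel)"
    by (simp add: s cis_mult algebra_simps)
  also have "\<dots> = (\<integral>\<^sup>+t. indicator A (cis (2 * pi * t)) * indicator {0..<1} t \<partial>lborel)"
  proof (rule nn_integral_periodic_shift)
    show "(\<lambda>t. indicator A (cis (2 * pi * t)) :: ennreal) \<in> borel_measurable borel"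
      by (rule measurable_compose[OF measurable_cis_circle ind])
    fix t :: real
    have "cis (2 * pi * (t + 1)) = cis (2 * pi * t)"
      by (simp add: distrib_left flip: cis_mult)
    thus "(indicator A (cis (2 * pi * (t + 1))) :: ennreal) = indicator A (cis (2 * pi * t))"
      by simp
  qed (use s in auto)
  also have "\<dots> = (\<integral>\<^sup>+z. indicator A z \<partial>haar_circle)"
    by (rule nn_integral_haar_circle[OF ind, symmetric])
  also have "\<dots> = emeasure haar_circle A"
    by (subst nn_integral_indicator) auto
  finally show "emeasure (distr haar_circle circle_borel (\<lambda>z. w * z)) A = emeasure haar_circle A" .
qed simp

lemma is_haar_prob_circle_haar_circle: "is_haar_prob_circle haar_circle"
  unfolding is_haar_prob_circle_def
  using prob_space_haar_circle haar_circle_rotate by simp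

lemma is_haar_prob_circle_unique:
  assumes "is_haar_prob_circle \<mu>" "is_haar_prob_circle \<nu>"
  shows "\<mu> = \<nu>"
proof (rule measure_eqI)
  have sets [simp, measurable_cong]: "sets \<mu> = sets circle_borel" "sets \<nu> = sets circle_borel"
    and rot: "\<And>w. w \<in> unit_circle \<Longrightarrow> distr \<mu> circle_borel (\<lambda>z. w * z) = \<mu>"
      "\<And>w. w \<in> unit_circle \<Longrightarrow> distr \<nu> circle_borel (\<lambda>z. w * z) = \<nu>"
    using assms by (auto simp: is_haar_prob_circle_def)
  interpret M: prob_space \<mu> using assms(1) by (simp add: is_haar_prob_circle_def)
  interpret N: prob_space \<nu> using assms(2) by (simp add: is_haar_prob_circle_def)
  interpret pair_sigma_finite \<mu> \<nu> ..
  have space: "space \<mu> = unit_circle" "space \<nu> = unit_circle"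
    using sets_eq_imp_space_eq[OF sets(1)] sets_eq_imp_space_eq[OF sets(2)]
    by (auto simp: space_restrict_space)
  show "sets \<mu> = sets \<nu>" by simp
  fix A assume "A \<in> sets \<mu>"
  hence A [measurable]: "A \<in> sets circle_borel" by simp
  have ind: "(indicator A :: complex \<Rightarrow> ennreal) \<in> borel_measurable circle_borel" by measurable
  have sp: "sets (\<mu> \<Otimes>\<^sub>M \<nu>) = sets (circle_borel \<Otimes>\<^sub>M circle_borel)"
    by (rule sets_pair_measure_cong) auto
  have "(\<lambda>p. indicator A (fst p * snd p) :: ennreal) \<in>
          borel_measurable (circle_borel \<Otimes>\<^sub>M circle_borel)"
    by (rule measurable_compose[OF measurable_mult_circle ind])
  hence meas: "(\<lambda>(z, w). indicator A (z * w) :: ennreal) \<in> borel_measurable (\<mu> \<Otimes>\<^sub>M \<nu>)"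
    by (simp add: measurable_cong_sets[OF sp refl] case_prod_beta)
  have inv: "(\<integral>\<^sup>+z. indicator A (w * z) \<partial>\<rho>) = emeasure \<rho> A"
    if "w \<in> unit_circle" and s: "sets \<rho> = sets circle_borel"
      and r: "distr \<rho> circle_borel (\<lambda>z. w * z) = \<rho>" for w and \<rho> :: "complex measure"
  proof -
    have "(\<lambda>z. w * z) \<in> \<rho> \<rightarrow>\<^sub>M circle_borel"
      using measurable_rotate_circle[OF that(1)] by (simp add: measurable_cong_sets[OF s refl])
    hence "(\<integral>\<^sup>+z. indicator A (w * z) \<partial>\<rho>) =
          (\<integral>\<^sup>+z. indicator A z \<partial>distr \<rho> circle_borel (\<lambda>z. w * z))"
      using ind by (subst nn_integral_distr) auto
    also have "\<dots> = emeasure \<rho> A"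
      unfolding r by (subst nn_integral_indicator) (auto simp: s)
    finally show ?thesis .
  qed
  have "emeasure \<mu> A = (\<integral>\<^sup>+w. emeasure \<mu> A \<partial>\<nu>)"
    by (simp add: N.emeasure_space_1)
  also have "\<dots> = (\<integral>\<^sup>+w. (\<integral>\<^sup>+z. indicator A (z * w) \<partial>\<mu>) \<partial>\<nu>)"
    using inv[OF _ sets(1) rot(1)]
    by (intro nn_integral_cong) (simp add: space mult.commute)
  also have "\<dots> = (\<integral>\<^sup>+z. (\<integral>\<^sup>+w. indicator A (z * w) \<partial>\<nu>) \<partial>\<mu>)"
    using Fubini[OF meas] by simp
  also have "\<dots> = (\<integral>\<^sup>+z. emeasure \<nu> A \<partial>\<mu>)"
    using inv[OF _ sets(2) rot(2)]
    by (intro nn_integral_cong) (simp add: space)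
  also have "\<dots> = emeasure \<nu> A"
    by (simp add: M.emeasure_space_1)
  finally show "emeasure \<mu> A = emeasure \<nu> A" .
qed

theorem is_haar_prob_circle_iff: "is_haar_prob_circle \<mu> \<longleftrightarrow> \<mu> = haar_circle"
  using is_haar_prob_circle_haar_circle is_haar_prob_circle_unique by blast


section \<open>Equidistribution modulo 1\<close>

text \<open>Weak convergence along a filter, for Borel measures living on the space \<open>X\<close>.\<close>
definition weakly_converges ::
  "'a::topological_space set \<Rightarrow> ('i \<Rightarrow> 'a measure) \<Rightarrow> 'a measure \<Rightarrow> 'i filter \<Rightarrow> bool"
  where "weakly_converges X M N \<F> \<longleftrightarrow>
    (\<forall>f :: 'a \<Rightarrow> real. continuous_on X f \<and> bounded (f ` X) \<longrightarrow>
       ((\<lambda>i. integral\<^sup>L (M i) f) \<longlongrightarrow> integral\<^sup>L N f) \<F>)"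

text \<open>\<open>F mod 1\<close>, with \<open>\<real>/\<int>\<close> identified with the circle via \<open>t \<mapsto> exp (2 \<pi> i t)\<close>.\<close>
definition mod1 :: "('a \<Rightarrow> real) \<Rightarrow> 'a \<Rightarrow> complex"
  where "mod1 F x = cis (2 * pi * F x)"

text \<open>
  The normalized counting measure on \<open>\<Gamma> \<inter> B\<^sub>R(0) \<inter> D\<close>. It is meaningful when this set
  is finite and nonempty; otherwise it degenerates to the zero measure.
\<close>
definition normalized_counting ::
  "(real ^ 'n) set \<Rightarrow> (real ^ 'n) set \<Rightarrow> real \<Rightarrow> (real ^ 'n) measure"
  where "normalized_counting \<Gamma> D R = uniform_count_measure (\<Gamma> \<inter> ball 0 R \<inter> D)"

definition equidistributed_mod1 ::
  "(real ^ 'n) set \<Rightarrow> (real ^ 'n) set \<Rightarrow> (real ^ 'n \<Rightarrow> real) \<Rightarrow> bool"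
  where "equidistributed_mod1 \<Gamma> D F \<longleftrightarrow>
    weakly_converges unit_circle
      (\<lambda>R. distr (normalized_counting \<Gamma> D R) circle_borel (mod1 F)) haar_circle at_top"

definition int_lattice :: "(real ^ 'n) set"
  where "int_lattice = {x. \<forall>i. x $ i \<in> \<int>}"

end

theory Submission
  imports Defs
begin

text \<open>
  By Weyl's criterion (\<open>weyl_criterion\<close>), it is enough that the means of \<open>exp (2 \<pi> i j F)\<close> over the
  lattice points of a ball tend to \<open>0\<close> for every integer \<open>j > 0\<close>. The polynomial \<open>j F\<close> satisfies the
  same hypothesis as \<open>F\<close>, so only \<open>F\<close> itself has to be treated, which is done in
  \<open>weyl_sum_tendsto_0\<close>.

  The proof is Weyl differencing, but the induction is on the largest degree of an irrational
  coefficient instead of on the degree of \<open>F\<close>. Let \<open>l\<close> be an exponent of this largest degree with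
  irrational coefficient, and let \<open>i\<close> be a coordinate occurring in \<open>l\<close>. The difference
  \<open>F (x + t e\<^sub>i) - F x\<close> has an irrational coefficient at \<open>l - e\<^sub>i\<close>, and only rational ones in degrees
  above that (\<open>diff_coeff_irrational\<close>, \<open>diff_coeff_degree\<close>). Rational coefficients of higher degree
  thus never have to be removed by passing to residue classes, and the differences along the
  single direction \<open>e\<^sub>i\<close> are all that van der Corput's argument (\<open>van_der_corput\<close>) requires.

  Differencing stops being useful once the irrational coefficients are all of degree at most \<open>1\<close>.
  Then a translation by \<open>q e\<^sub>i\<close>, with \<open>q\<close> a common denominator of the higher coefficients, changes
  \<open>F\<close> by an irrational constant modulo integers. It multiplies the exponential by a number other
  than \<open>1\<close>, while means over large balls are almost translation invariant
  (\<open>lattice_mean_eigenfunction\<close>).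

  The only geometric input is that enlarging a ball by a bounded amount changes the number of
  its lattice points by a factor tending to \<open>1\<close> (\<open>lattice_ball_growth\<close>), which follows by comparing
  this number with a volume.
\<close>

section \<open>Counting lattice points in balls\<close>

abbreviation lattice_ball :: "real \<Rightarrow> (real ^ 'n) set"
  where "lattice_ball R \<equiv> int_lattice \<inter> ball 0 R"

lemma zero_in_int_lattice [simp]: "0 \<in> int_lattice"
  by (simp add: int_lattice_def)

lemma add_in_int_lattice: "x \<in> int_lattice \<Longrightarrow> y \<in> int_lattice \<Longrightarrow> x + y \<in> int_lattice"
  by (simp add: int_lattice_def)

lemma scaleR_in_int_lattice: "c \<in> \<int> \<Longrightarrow> x \<in> int_lattice \<Longrightarrow> c *\<^sub>R x \<in> int_lattice"
  by (simp add: int_lattice_def)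

lemma axis_in_int_lattice: "axis i 1 \<in> int_lattice"
  by (simp add: int_lattice_def axis_def)

lemma finite_lattice_ball [simp]: "finite (lattice_ball R :: (real ^ 'n) set)"
proof (rule finite_subset)
  let ?I = "{- \<lceil>R\<rceil>..\<lceil>R\<rceil>}"
  show "lattice_ball R \<subseteq> (\<lambda>f :: 'n \<Rightarrow> int. \<chi> i. of_int (f i)) ` (PiE UNIV (\<lambda>_. ?I))"
  proof
    fix x :: "real ^ 'n" assume x: "x \<in> lattice_ball R"
    have "x $ i = of_int \<lfloor>x $ i\<rfloor>" for i
      using x by (auto simp: int_lattice_def elim!: Ints_cases)
    moreover have "\<lfloor>x $ i\<rfloor> \<in> ?I" for i
    proof -
      have "\<bar>x $ i\<bar> \<le> R" using x component_le_norm_cart[of x i] by auto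
      thus ?thesis by (auto simp: le_floor_iff) linarith+
    qed
    ultimately show "x \<in> (\<lambda>f :: 'n \<Rightarrow> int. \<chi> i. of_int (f i)) ` (PiE UNIV (\<lambda>_. ?I))"
      by (intro image_eqI[where x = "\<lambda>i. \<lfloor>x $ i\<rfloor>"]) (auto simp: vec_eq_iff)
  qed
  show "finite ((\<lambda>f :: 'n \<Rightarrow> int. (\<chi> i. of_int (f i)) :: real ^ 'n) ` (PiE UNIV (\<lambda>_. ?I)))"
    by (intro finite_imageI finite_PiE) auto
qed

lemma norm_diff_le_of_unit_cube:
  fixes x y :: "real ^ 'n"
  assumes "\<And>i. x $ i \<le> y $ i" "\<And>i. y $ i \<le> x $ i + 1"
  shows "norm (y - x) \<le> real CARD('n)"
proof -
  have "norm (y - x) \<le> (\<Sum>i\<in>UNIV. \<bar>(y - x) $ i\<bar>)" by (rule norm_le_l1_cart)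
  also have "\<dots> \<le> (\<Sum>i\<in>(UNIV :: 'n set). 1)"
    using assms
    by (intro sum_mono)
       (auto simp: abs_le_iff algebra_simps intro: order_trans[OF _ le_add_same_cancel1[THEN iffD2]])
  finally show ?thesis by simp
qed

lemma content_unit_cube:
  fixes x :: "real ^ 'n"
  shows "measure lborel (cbox x (x + 1)) = 1" "measure lborel (box x (x + 1)) = 1"
proof -
  show "measure lborel (cbox x (x + 1)) = 1"
    by (subst content_cbox_cart) (auto simp: interval_ne_empty_cart)
  thus "measure lborel (box x (x + 1)) = 1"
    by (simp add: measure_lborel_box_eq measure_lborel_cbox_eq)
qed

text \<open>
  The open unit cubes with lower corner at the lattice points of the ball are disjoint, have volume
  \<open>1\<close> and lie in a ball whose radius exceeds \<open>R\<close> by the diameter of a cube, for which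
  \<open>CARD('n)\<close> is a convenient bound.
\<close>
lemma card_lattice_ball_upper:
  assumes "R \<ge> 0"
  shows "real (card (lattice_ball R :: (real ^ 'n) set))
           \<le> unit_ball_vol (real CARD('n)) * (R + real CARD('n)) ^ CARD('n)"
proof -
  let ?S = "lattice_ball R :: (real ^ 'n) set"
  have disj: "disjoint_family_on (\<lambda>x. box x (x + 1)) ?S"
    unfolding disjoint_family_on_def
  proof (intro ballI impI)
    fix x y :: "real ^ 'n" assume xy: "x \<in> ?S" "y \<in> ?S" "x \<noteq> y"
    have "x = y" if z: "z \<in> box x (x + 1)" "z \<in> box y (y + 1)" for z
    proof -
      have "x $ i = y $ i" for i
      proof -
        obtain a b where ab: "x $ i = of_int a" "y $ i = of_int b"
          using xy by (auto simp: int_lattice_def elim!: Ints_cases) (metis Ints_cases)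
        have "of_int a < z $ i" "z $ i < of_int a + 1" "of_int b < z $ i" "z $ i < of_int b + 1"
          using z ab by (auto simp: mem_box_cart) metis+
        hence "a = b" by linarith
        thus ?thesis using ab by simp
      qed
      thus ?thesis by (simp add: vec_eq_iff)
    qed
    thus "box x (x + 1) \<inter> box y (y + 1) = {}" using xy by blast
  qed
  have "real (card ?S) = (\<Sum>x\<in>?S. measure lborel (box x (x + 1)))"
    by (simp add: content_unit_cube)
  also have "\<dots> = measure lborel (\<Union>x\<in>?S. box x (x + 1))"
    by (rule measure_finite_Union[symmetric])
       (use disj emeasure_lborel_box_finite in \<open>auto simp: less_top\<close>)
  also have "\<dots> \<le> measure lborel (ball 0 (R + real CARD('n)) :: (real ^ 'n) set)"
  proof (rule measure_mono_fmeasurable)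
    show "(\<Union>x\<in>?S. box x (x + 1)) \<subseteq> ball 0 (R + real CARD('n))"
    proof safe
      fix x y :: "real ^ 'n" assume x: "x \<in> ball 0 R" and y: "y \<in> box x (x + 1)"
      have "norm (y - x) \<le> real CARD('n)"
        using y by (intro norm_diff_le_of_unit_cube) (auto simp: mem_box_cart less_imp_le)
      hence "norm y < R + real CARD('n)"
        using x norm_triangle_sub[of y x] by auto
      thus "y \<in> ball 0 (R + real CARD('n))" by simp
    qed
    show "ball 0 (R + real CARD('n)) \<in> fmeasurable (lborel :: (real ^ 'n) measure)"
      by (rule fmeasurableI) (use emeasure_bounded_finite[OF bounded_ball] in \<open>auto simp: less_top\<close>)
  qed auto
  also have "\<dots> = unit_ball_vol (real CARD('n)) * (R + real CARD('n)) ^ CARD('n)"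
    using content_ball[of "R + real CARD('n)" "0 :: real ^ 'n"] assms by simp
  finally show ?thesis .
qed

text \<open>
  Rounding down the coordinates of a point of the smaller ball gives a lattice point of the larger
  one, so the closed unit cubes at the lattice points of the larger ball cover the smaller ball.
\<close>
lemma card_lattice_ball_lower:
  assumes "R \<ge> real CARD('n)"
  shows "unit_ball_vol (real CARD('n)) * (R - real CARD('n)) ^ CARD('n)
           \<le> real (card (lattice_ball R :: (real ^ 'n) set))"
proof -
  let ?S = "lattice_ball R :: (real ^ 'n) set"
  have "unit_ball_vol (real CARD('n)) * (R - real CARD('n)) ^ CARD('n) =
        measure lborel (ball 0 (R - real CARD('n)) :: (real ^ 'n) set)"
    using content_ball[of "R - real CARD('n)" "0 :: real ^ 'n"] assms by simp
  also have "\<dots> \<le> measure lborel (\<Union>x\<in>?S. cbox x (x + 1))"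
  proof (rule measure_mono_fmeasurable)
    show "ball 0 (R - real CARD('n)) \<subseteq> (\<Union>x\<in>?S. cbox x (x + 1))"
    proof
      fix y :: "real ^ 'n" assume y: "y \<in> ball 0 (R - real CARD('n))"
      let ?x = "(\<chi> i. of_int \<lfloor>y $ i\<rfloor>) :: real ^ 'n"
      have "norm (y - ?x) \<le> real CARD('n)"
        by (intro norm_diff_le_of_unit_cube) (auto simp: less_imp_le)
      hence "norm ?x < R"
        using y norm_triangle_sub[of ?x y] by (auto simp: norm_minus_commute)
      hence "?x \<in> ?S" by (simp add: int_lattice_def)
      moreover have "y \<in> cbox ?x (?x + 1)" by (auto simp: mem_box_cart less_imp_le)
      ultimately show "y \<in> (\<Union>x\<in>?S. cbox x (x + 1))" by blast
    qed
  qed (auto intro!: fmeasurable.finite_UN)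
  also have "\<dots> \<le> (\<Sum>x\<in>?S. measure lborel (cbox x (x + 1)))"
    by (rule measure_UNION_le) auto
  also have "\<dots> = real (card ?S)"
    by (simp add: content_unit_cube)
  finally show ?thesis .
qed

text \<open>
  Enlarging the radius by a constant adds a negligible proportion of lattice points. This makes the
  lattice balls a Folner sequence for the translations of \<open>int_lattice\<close>; it is the only
  property of balls that the estimates of exponential sums depend on.
\<close>
lemma lattice_ball_growth:
  assumes "c \<ge> 0"
  shows "((\<lambda>R. real (card (lattice_ball (R + c) :: (real ^ 'n) set)) /
               real (card (lattice_ball R :: (real ^ 'n) set))) \<longlongrightarrow> 1) at_top"
proof (rule tendsto_sandwich)
  let ?N = "\<lambda>R. real (card (lattice_ball R :: (real ^ 'n) set))"
  let ?n = "real CARD('n)"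
  have vol: "unit_ball_vol (real CARD('n)) > 0" by simp
  have ev: "eventually (\<lambda>R. R > ?n) at_top" by (rule eventually_gt_at_top)
  have pos: "?N R > 0" if "R > ?n" for R
  proof -
    have "0 < unit_ball_vol (real CARD('n)) * (R - ?n) ^ CARD('n)" using that vol by simp
    also have "\<dots> \<le> ?N R" using card_lattice_ball_lower[where 'n = 'n, of R] that by simp
    finally show ?thesis .
  qed
  show "eventually (\<lambda>R. 1 \<le> ?N (R + c) / ?N R) at_top"
    using ev
  proof eventually_elim
    case (elim R)
    have "card (lattice_ball R :: (real ^ 'n) set) \<le> card (lattice_ball (R + c) :: (real ^ 'n) set)"
      using assms by (intro card_mono) auto
    thus ?case using pos[OF elim] by (simp add: field_simps)
  qed
  show "eventually (\<lambda>R. ?N (R + c) / ?N R \<le> ((R + c + ?n) / (R - ?n)) ^ CARD('n)) at_top"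
    using ev
  proof eventually_elim
    case (elim R)
    have R: "R \<ge> 0" using elim by (meson less_imp_le of_nat_0_le_iff order_trans)
    have "?N (R + c) / ?N R \<le> (unit_ball_vol (real CARD('n)) * (R + c + ?n) ^ CARD('n)) /
            (unit_ball_vol (real CARD('n)) * (R - ?n) ^ CARD('n))"
      using card_lattice_ball_upper[where 'n = 'n, of "R + c"]
            card_lattice_ball_lower[where 'n = 'n, of R] elim assms R vol
      by (intro frac_le) auto
    also have "\<dots> = ((R + c + ?n) / (R - ?n)) ^ CARD('n)"
      unfolding power_divide by (rule mult_divide_mult_cancel_left[OF less_imp_neq[OF vol, symmetric]])
    finally show ?case .
  qed
  have "((\<lambda>R. (R + c + ?n) / (R - ?n)) \<longlongrightarrow> 1) at_top" by real_asymp
  from tendsto_power[OF this, of "CARD('n)"]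
  show "((\<lambda>R. ((R + c + ?n) / (R - ?n)) ^ CARD('n)) \<longlongrightarrow> 1) at_top" by simp
qed simp

section \<open>Means over lattice balls\<close>

definition finite_mean :: "'a set \<Rightarrow> ('a \<Rightarrow> complex) \<Rightarrow> complex"
  where "finite_mean S u = (\<Sum>x\<in>S. u x) / of_nat (card S)"

lemma finite_mean_cong: "(\<And>x. x \<in> S \<Longrightarrow> u x = v x) \<Longrightarrow> finite_mean S u = finite_mean S v"
  by (simp add: finite_mean_def)

lemma finite_mean_cmult: "finite_mean S (\<lambda>x. c * u x) = c * finite_mean S u"
  by (simp add: finite_mean_def sum_distrib_left)

lemma finite_mean_sum: "finite_mean S (\<lambda>x. \<Sum>i\<in>I. f i x) = (\<Sum>i\<in>I. finite_mean S (f i))"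
  unfolding finite_mean_def by (subst sum.swap) (simp add: sum_divide_distrib)

lemma finite_mean_cnj: "finite_mean S (\<lambda>x. cnj (u x)) = cnj (finite_mean S u)"
  by (simp add: finite_mean_def)

lemma finite_mean_const: "finite S \<Longrightarrow> S \<noteq> {} \<Longrightarrow> finite_mean S (\<lambda>_. c) = c"
  by (simp add: finite_mean_def)

lemma norm_finite_mean_squared_le:
  "(norm (finite_mean S u))\<^sup>2 \<le> (\<Sum>x\<in>S. (norm (u x))\<^sup>2) / real (card S)"
proof (cases "card S = 0")
  case False
  have "(norm (\<Sum>x\<in>S. u x))\<^sup>2 \<le> (\<Sum>x\<in>S. 1 * norm (u x))\<^sup>2"
    by (intro power_mono) (auto intro: norm_sum)
  also have "\<dots> \<le> (\<Sum>x\<in>S. 1\<^sup>2) * (\<Sum>x\<in>S. (norm (u x))\<^sup>2)"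
    by (rule Cauchy_Schwarz_ineq_sum)
  finally show ?thesis
    using False by (simp add: finite_mean_def norm_divide power_divide field_simps power2_eq_square)
qed (simp add: finite_mean_def)

lemma eventually_lattice_ball_nonempty:
  "eventually (\<lambda>R. (lattice_ball R :: (real ^ 'n) set) \<noteq> {}) at_top"
  using eventually_gt_at_top[of 0]
proof eventually_elim
  case (elim R)
  hence "0 \<in> (lattice_ball R :: (real ^ 'n) set)" by simp
  thus ?case by blast
qed

text \<open>
  The ball and its translate both lie in the ball whose radius is larger by \<open>norm v\<close>, and each
  misses only a negligible part of it by \<open>lattice_ball_growth\<close>.
\<close>
lemma lattice_mean_shift:
  fixes u :: "real ^ 'n \<Rightarrow> complex"
  assumes v: "v \<in> int_lattice" and u: "\<And>x. norm (u x) \<le> 1"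
  shows "((\<lambda>R. finite_mean (lattice_ball R) (\<lambda>x. u (x + v)) - finite_mean (lattice_ball R) u)
            \<longlongrightarrow> 0) at_top"
proof (rule Lim_null_comparison)
  let ?B = "\<lambda>R. lattice_ball R :: (real ^ 'n) set"
  let ?N = "\<lambda>R. real (card (?B R))"
  let ?c = "norm v"
  show "((\<lambda>R. 2 * (?N (R + ?c) / ?N R - 1)) \<longlongrightarrow> 0) at_top"
    using tendsto_mult_left[OF tendsto_diff[OF lattice_ball_growth[where 'n = 'n, of ?c] tendsto_const[of 1]], of 2]
    by simp
  show "eventually (\<lambda>R. norm (finite_mean (?B R) (\<lambda>x. u (x + v)) - finite_mean (?B R) u)
          \<le> 2 * (?N (R + ?c) / ?N R - 1)) at_top"
    using eventually_lattice_ball_nonempty[where 'n = 'n]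
  proof eventually_elim
    case (elim R)
    let ?T = "?B (R + ?c)"
    let ?S' = "(\<lambda>x. x + v) ` ?B R"
    have inj: "inj_on (\<lambda>x. x + v) (?B R)" by (simp add: inj_on_def)
    have defect: "norm (sum u ?T - sum u S) \<le> real (card ?T) - real (card S)"
      if "S \<subseteq> ?T" for S
    proof -
      have "finite S" using that finite_subset finite_lattice_ball by blast
      have "norm (sum u ?T - sum u S) = norm (sum u (?T - S))"
        using that by (subst sum_diff) auto
      also have "\<dots> \<le> real (card (?T - S)) * 1"
        by (rule sum_norm_bound[where K = 1, simplified, THEN order_trans]) (use u in auto)
      also have "\<dots> = real (card ?T) - real (card S)"
        using that by (simp add: card_Diff_subset \<open>finite S\<close> card_mono of_nat_diff)
      finally show ?thesis .
    qed
    have "?S' \<subseteq> ?T"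
    proof safe
      fix x :: "real ^ 'n" assume "x \<in> int_lattice" "x \<in> ball 0 R"
      thus "x + v \<in> int_lattice" "x + v \<in> ball 0 (R + ?c)"
        using norm_triangle_ineq[of x v] v by (auto intro: add_in_int_lattice)
    qed
    have "(\<Sum>x\<in>?B R. u (x + v)) = sum u ?S'"
      by (simp add: sum.reindex[OF inj])
    hence "norm ((\<Sum>x\<in>?B R. u (x + v)) - (\<Sum>x\<in>?B R. u x)) =
        norm ((sum u ?T - sum u (?B R)) - (sum u ?T - sum u ?S'))"
      by simp
    also have "\<dots> \<le> norm (sum u ?T - sum u (?B R)) + norm (sum u ?T - sum u ?S')"
      by (rule norm_triangle_ineq4)
    also have "\<dots> \<le> (real (card ?T) - ?N R) + (real (card ?T) - real (card ?S'))"
      by (intro add_mono defect \<open>?S' \<subseteq> ?T\<close> Int_mono subset_ball) auto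
    also have "card ?S' = card (?B R)" by (rule card_image[OF inj])
    finally have "norm ((\<Sum>x\<in>?B R. u (x + v)) - (\<Sum>x\<in>?B R. u x)) \<le> 2 * (?N (R + ?c) - ?N R)"
      by simp
    moreover have "?N R > 0" using elim by (simp add: card_gt_0_iff)
    ultimately show ?case
      by (simp add: finite_mean_def norm_divide field_simps flip: diff_divide_distrib)
  qed
qed

text \<open>
  Translation by \<open>v\<close> multiplies the mean by \<open>w\<close>, yet changes it by a quantity tending to \<open>0\<close>.
\<close>
lemma lattice_mean_eigenfunction:
  fixes u :: "real ^ 'n \<Rightarrow> complex"
  assumes v: "v \<in> int_lattice" and u: "\<And>x. norm (u x) \<le> 1"
    and eigen: "\<And>x. x \<in> int_lattice \<Longrightarrow> u (x + v) = w * u x" and "w \<noteq> 1"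
  shows "((\<lambda>R. finite_mean (lattice_ball R) u) \<longlongrightarrow> 0) at_top"
proof -
  have "finite_mean (lattice_ball R) (\<lambda>x. u (x + v)) = w * finite_mean (lattice_ball R) u" for R
    unfolding finite_mean_cmult[symmetric] by (rule finite_mean_cong) (simp add: eigen)
  hence "((\<lambda>R. (w - 1) * finite_mean (lattice_ball R) u) \<longlongrightarrow> 0) at_top"
    using lattice_mean_shift[of v u, OF v u] by (simp add: algebra_simps)
  from tendsto_mult_left[OF this, of "1 / (w - 1)"] show ?thesis
    using \<open>w \<noteq> 1\<close> by simp
qed

section \<open>Van der Corput's difference theorem\<close>

text \<open>
  The mean of \<open>u\<close> is asymptotically the mean of its average \<open>A\<close> over \<open>H\<close> successive translates by
  \<open>v\<close>. By Cauchy--Schwarz the latter is at most the square root of the mean of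
  \<open>\<bar>A\<bar>\<^sup>2\<close>. Expanding that square, the \<open>H\<close> diagonal terms each contribute \<open>1 / H\<^sup>2\<close>
  and the others vanish in the limit by the hypothesis on correlations, which leaves
  \<open>1 / sqrt H\<close>; and \<open>H\<close> is arbitrary. Only correlations along the multiples of a single
  vector \<open>v\<close> enter, so in an application the direction of \<open>v\<close> can be chosen freely.
\<close>
lemma van_der_corput:
  fixes u :: "real ^ 'n \<Rightarrow> complex"
  assumes v: "v \<in> int_lattice" and u: "\<And>x. norm (u x) = 1"
    and corr: "\<And>d :: nat. d > 0 \<Longrightarrow>
      ((\<lambda>R. finite_mean (lattice_ball R) (\<lambda>x. u (x + real d *\<^sub>R v) * cnj (u x))) \<longlongrightarrow> 0) at_top"
  shows "((\<lambda>R. finite_mean (lattice_ball R) u) \<longlongrightarrow> 0) at_top"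
proof (rule tendstoI)
  fix e :: real assume e: "e > 0"
  let ?B = "\<lambda>R. lattice_ball R :: (real ^ 'n) set"
  have mult_v: "real s *\<^sub>R v \<in> int_lattice" for s
    using v by (intro scaleR_in_int_lattice) auto
  \<comment> \<open>the correlation at distance \<open>s - t\<close>, translated by \<open>t v\<close>\<close>
  have pair: "((\<lambda>R. finite_mean (?B R) (\<lambda>x. u (x + real s *\<^sub>R v) * cnj (u (x + real t *\<^sub>R v))))
                 \<longlongrightarrow> 0) at_top" if "t < s" for s t
  proof -
    let ?w = "\<lambda>x. u (x + real (s - t) *\<^sub>R v) * cnj (u x)"
    have w: "norm (?w x) \<le> 1" for x by (simp add: norm_mult u)
    have "u (x + real t *\<^sub>R v + real (s - t) *\<^sub>R v) * cnj (u (x + real t *\<^sub>R v)) = u (x + real s *\<^sub>R v) * cnj (u (x + real t *\<^sub>R v))" for x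
      using that by (simp add: of_nat_diff algebra_simps)
    hence shifted: "finite_mean (?B R) (\<lambda>x. ?w (x + real t *\<^sub>R v)) =
        finite_mean (?B R) (\<lambda>x. u (x + real s *\<^sub>R v) * cnj (u (x + real t *\<^sub>R v)))" for R
      by (intro finite_mean_cong)
    have "((\<lambda>R. finite_mean (?B R) (\<lambda>x. ?w (x + real t *\<^sub>R v)) - finite_mean (?B R) ?w
        + finite_mean (?B R) ?w) \<longlongrightarrow> 0 + 0) at_top"
      using that by (intro tendsto_add lattice_mean_shift mult_v w corr) simp
    thus ?thesis unfolding shifted by simp
  qed
  have diag: "((\<lambda>R. finite_mean (?B R) (\<lambda>x. u (x + real s *\<^sub>R v) * cnj (u (x + real t *\<^sub>R v))))
                 \<longlongrightarrow> (if s = t then 1 else 0)) at_top" for s t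
  proof (cases s t rule: linorder_cases)
    case equal
    have "u y * cnj (u y) = 1" for y
      using complex_norm_square[of "u y"] u[of y] by simp
    moreover have "eventually (\<lambda>R. finite_mean (?B R) (\<lambda>x. 1) = 1) at_top"
      using eventually_lattice_ball_nonempty[where 'n = 'n]
      by eventually_elim (simp add: finite_mean_const)
    ultimately show ?thesis using equal by (simp add: tendsto_eventually)
  next
    case less
    from tendsto_cnj[OF pair[OF less]] show ?thesis
      using less by (simp add: mult.commute flip: finite_mean_cnj)
  qed (simp add: pair)
  obtain H :: nat where H: "H > 0" "1 / real H < (e / 2)\<^sup>2"
  proof -
    obtain H :: nat where "real H > 1 / (e / 2)\<^sup>2" using reals_Archimedean2 by blast
    moreover from this have "H > 0" using e by (cases H) (auto simp: zero_less_divide_iff not_less)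
    ultimately show ?thesis using e by (intro that[of H]) (auto simp: field_simps)
  qed
  define A where "A x = (1 / of_nat H) * (\<Sum>s<H. u (x + real s *\<^sub>R v))" for x
  have mean_A: "((\<lambda>R. finite_mean (?B R) A - finite_mean (?B R) u) \<longlongrightarrow> 0) at_top"
  proof -
    have "((\<lambda>R. (1 / of_nat H) * (\<Sum>s<H. finite_mean (?B R) (\<lambda>x. u (x + real s *\<^sub>R v))
             - finite_mean (?B R) u)) \<longlongrightarrow> (1 / of_nat H) * (\<Sum>s<H. 0)) at_top"
      by (intro tendsto_mult_left tendsto_sum lattice_mean_shift mult_v) (simp add: u)
    moreover have "(1 / of_nat H) * (\<Sum>s<H. finite_mean (?B R) (\<lambda>x. u (x + real s *\<^sub>R v))
             - finite_mean (?B R) u) = finite_mean (?B R) A - finite_mean (?B R) u" for R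
      unfolding A_def finite_mean_cmult finite_mean_sum using H by (simp add: sum_subtractf algebra_simps)
    ultimately show ?thesis by simp
  qed
  have square_A: "((\<lambda>R. finite_mean (?B R) (\<lambda>x. A x * cnj (A x))) \<longlongrightarrow> 1 / of_nat H) at_top"
  proof -
    have "((\<lambda>R. (1 / of_nat H)\<^sup>2 * (\<Sum>s<H. \<Sum>t<H. finite_mean (?B R)
              (\<lambda>x. u (x + real s *\<^sub>R v) * cnj (u (x + real t *\<^sub>R v)))))
            \<longlongrightarrow> (1 / of_nat H)\<^sup>2 * (\<Sum>s<H. \<Sum>t<H. if s = t then 1 else 0 :: complex)) at_top"
      by (intro tendsto_mult_left tendsto_sum diag)
    moreover have "(1 / of_nat H)\<^sup>2 * (\<Sum>s<H. \<Sum>t<H. if s = t then 1 else 0 :: complex) = 1 / of_nat H"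
      using H by (simp add: power2_eq_square)
    moreover have "A x * cnj (A x) = (1 / of_nat H)\<^sup>2 *
        (\<Sum>s<H. \<Sum>t<H. u (x + real s *\<^sub>R v) * cnj (u (x + real t *\<^sub>R v)))" for x
      by (simp add: A_def power2_eq_square sum_product)
    ultimately show ?thesis by (simp add: finite_mean_cmult finite_mean_sum)
  qed
  have Jensen: "norm (finite_mean (?B R) A) \<le> sqrt (Re (finite_mean (?B R) (\<lambda>x. A x * cnj (A x))))" for R
  proof -
    have "finite_mean (?B R) (\<lambda>x. A x * cnj (A x)) =
        of_real ((\<Sum>x\<in>?B R. (norm (A x))\<^sup>2) / real (card (?B R)))"
      unfolding finite_mean_def complex_norm_square[symmetric] by simp
    thus ?thesis
      using norm_finite_mean_squared_le[of "?B R" A] by (intro real_le_rsqrt) simp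
  qed
  have "sqrt (1 / real H) < e / 2"
    using H e by (intro real_less_lsqrt) auto
  moreover have "((\<lambda>R. sqrt (Re (finite_mean (?B R) (\<lambda>x. A x * cnj (A x))))) \<longlongrightarrow> sqrt (1 / real H)) at_top"
    using tendsto_real_sqrt[OF tendsto_Re[OF square_A]] by simp
  ultimately have "eventually (\<lambda>R. sqrt (Re (finite_mean (?B R) (\<lambda>x. A x * cnj (A x)))) < e / 2) at_top"
    by (rule order_tendstoD(2)[rotated])
  moreover have "eventually (\<lambda>R. norm (finite_mean (?B R) A - finite_mean (?B R) u) < e / 2) at_top"
    using tendstoD[OF mean_A, of "e / 2"] e by simp
  ultimately show "eventually (\<lambda>R. dist (finite_mean (?B R) u) 0 < e) at_top"
  proof eventually_elim
    case (elim R)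
    have "norm (finite_mean (?B R) u) \<le>
        norm (finite_mean (?B R) A) + norm (finite_mean (?B R) A - finite_mean (?B R) u)"
      by (metis norm_minus_commute norm_triangle_sub)
    with elim Jensen[of R] show ?case by simp
  qed
qed

section \<open>Differences of polynomials\<close>

definition multi_power :: "real ^ 'n \<Rightarrow> ('n \<Rightarrow> nat) \<Rightarrow> real"
  where "multi_power x l = (\<Prod>i\<in>UNIV. (x $ i) ^ l i)"

definition poly_sum :: "('n \<Rightarrow> nat) set \<Rightarrow> (('n \<Rightarrow> nat) \<Rightarrow> real) \<Rightarrow> real ^ 'n \<Rightarrow> real"
  where "poly_sum A a x = (\<Sum>l\<in>A. a l * multi_power x l)"

abbreviation total_degree :: "('n::finite \<Rightarrow> nat) \<Rightarrow> nat"
  where "total_degree l \<equiv> sum l UNIV"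

text \<open>
  Writing \<open>x\<^sup>l\<close> for \<open>multi_power x l\<close>, this is the coefficient of \<open>x\<^sup>m\<close> in the difference
  \<open>(x + t e\<^sub>i)\<^sup>l - x\<^sup>l\<close>. As a natural number, it preserves rationality of the coefficients it
  multiplies.
\<close>
definition diff_coeff :: "'n \<Rightarrow> nat \<Rightarrow> ('n \<Rightarrow> nat) \<Rightarrow> ('n \<Rightarrow> nat) \<Rightarrow> nat"
  where "diff_coeff i t l m =
    (if m = l(i := m i) \<and> m i < l i then (l i choose m i) * t ^ (l i - m i) else 0)"

text \<open>
  The exponents that can occur in the difference in direction \<open>i\<close> of a polynomial with
  exponents in \<open>A\<close>.
\<close>
definition lowered :: "('n \<Rightarrow> nat) set \<Rightarrow> 'n \<Rightarrow> ('n \<Rightarrow> nat) set"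
  where "lowered A i = (\<Union>l\<in>A. (\<lambda>j. l(i := j)) ` {..<l i})"

lemma finite_lowered: "finite A \<Longrightarrow> finite (lowered A i)"
  by (simp add: lowered_def)

lemma total_degree_fun_upd: "total_degree (l(i := j)) + l i = total_degree l + j"
proof -
  have "total_degree (l(i := j)) = j + sum l (UNIV - {i})" for j
    by (subst sum.remove[of _ i]) (auto intro!: sum.cong)
  from this[of j] this[of "l i"] show ?thesis by simp
qed

text \<open>
  Differencing lowers the degree of every monomial, so a coefficient of the difference at \<open>m\<close> only
  involves original coefficients of degree greater than that of \<open>m\<close>.
\<close>
lemma diff_coeff_degree:
  assumes "diff_coeff i t l m \<noteq> 0"
  shows "total_degree m < total_degree l"
proof -
  have "m = l(i := m i)" "m i < l i" using assms by (auto simp: diff_coeff_def split: if_splits)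
  moreover have "total_degree (l(i := m i)) + l i = total_degree l + m i"
    by (rule total_degree_fun_upd)
  ultimately show ?thesis by (metis add_less_cancel_left add_less_cancel_right)
qed

text \<open>
  With \<open>t\<close> a common denominator, this makes the differences of monomials with rational
  coefficients integer valued on the lattice.
\<close>
lemma diff_coeff_dvd: "t dvd diff_coeff i t l m"
  by (auto simp: diff_coeff_def intro!: dvd_mult dvd_power)

lemma multi_power_difference:
  fixes x :: "real ^ 'n"
  shows "multi_power (x + real t *\<^sub>R axis i 1) l - multi_power x l =
    (\<Sum>j<l i. real (l i choose j) * real t ^ (l i - j) * multi_power x (l(i := j)))"
proof -
  define P where "P = (\<Prod>k\<in>UNIV - {i}. (x $ k) ^ l k)"
  have split: "multi_power y m = (y $ i) ^ m i * (\<Prod>k\<in>UNIV - {i}. (y $ k) ^ m k)" for y :: "real ^ 'n" and m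
    unfolding multi_power_def by (rule prod.remove) auto
  have "multi_power (x + real t *\<^sub>R axis i 1) l = (x $ i + real t) ^ l i * P"
    unfolding split P_def by (auto simp: axis_def intro!: prod.cong)
  also have "(x $ i + real t) ^ l i = (\<Sum>j\<le>l i. real (l i choose j) * (x $ i) ^ j * real t ^ (l i - j))"
    by (simp add: binomial_ring)
  also have "{..l i} = insert (l i) {..<l i}" by auto
  also have "(\<Sum>j\<in>insert (l i) {..<l i}. real (l i choose j) * (x $ i) ^ j * real t ^ (l i - j)) * P =
      (\<Sum>j<l i. real (l i choose j) * real t ^ (l i - j) * ((x $ i) ^ j * P)) + multi_power x l"
    unfolding split[of x l] P_def[symmetric] by (simp add: sum_distrib_right sum_distrib_left mult_ac add.commute distrib_left)
  also have "(\<Sum>j<l i. real (l i choose j) * real t ^ (l i - j) * ((x $ i) ^ j * P)) =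
      (\<Sum>j<l i. real (l i choose j) * real t ^ (l i - j) * multi_power x (l(i := j)))"
    unfolding split P_def by (auto intro!: sum.cong prod.cong)
  finally show ?thesis by simp
qed

lemma poly_sum_difference:
  fixes x :: "real ^ 'n"
  assumes A: "finite A"
  shows "poly_sum A a (x + real t *\<^sub>R axis i 1) - poly_sum A a x =
    poly_sum (lowered A i) (\<lambda>m. \<Sum>l\<in>A. a l * real (diff_coeff i t l m)) x"
proof -
  have mono: "(\<Sum>m\<in>lowered A i. real (diff_coeff i t l m) * multi_power x m) =
      multi_power (x + real t *\<^sub>R axis i 1) l - multi_power x l" if "l \<in> A" for l
  proof -
    have inj: "inj_on (\<lambda>j. l(i := j)) {..<l i}"
      by (rule inj_onI) (metis fun_upd_same)
    have "(\<Sum>m\<in>lowered A i. real (diff_coeff i t l m) * multi_power x m) =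
          (\<Sum>m\<in>(\<lambda>j. l(i := j)) ` {..<l i}. real (diff_coeff i t l m) * multi_power x m)"
    proof (rule sum.mono_neutral_right)
      show "\<forall>m\<in>lowered A i - (\<lambda>j. l(i := j)) ` {..<l i}. real (diff_coeff i t l m) * multi_power x m = 0"
        by (auto simp: diff_coeff_def image_iff)
    qed (use A that in \<open>auto simp: finite_lowered lowered_def\<close>)
    also have "\<dots> = (\<Sum>j<l i. real (diff_coeff i t l (l(i := j))) * multi_power x (l(i := j)))"
      by (simp add: sum.reindex[OF inj])
    also have "\<dots> = multi_power (x + real t *\<^sub>R axis i 1) l - multi_power x l"
      unfolding multi_power_difference by (intro sum.cong) (auto simp: diff_coeff_def)
    finally show ?thesis .
  qed
  have "poly_sum (lowered A i) (\<lambda>m. \<Sum>l\<in>A. a l * real (diff_coeff i t l m)) x =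
        (\<Sum>l\<in>A. a l * (\<Sum>m\<in>lowered A i. real (diff_coeff i t l m) * multi_power x m))"
    unfolding poly_sum_def sum_distrib_right sum_distrib_left
    by (subst sum.swap) (simp add: mult.assoc)
  also have "\<dots> = poly_sum A a (x + real t *\<^sub>R axis i 1) - poly_sum A a x"
    by (simp add: mono poly_sum_def right_diff_distrib sum_subtractf)
  finally show ?thesis by simp
qed

text \<open>
  Take \<open>l\<^sub>0\<close> of maximal degree among the exponents with irrational coefficient. The coefficient of the
  difference at \<open>l\<^sub>0 - e\<^sub>i\<close> receives \<open>t l\<^sub>0(i) a(l\<^sub>0)\<close> from \<open>l\<^sub>0\<close> itself. All other contributions
  come from exponents \<open>l\<^sub>0 + r e\<^sub>i\<close> with \<open>r > 0\<close>, whose degree is larger and whose coefficients are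
  therefore rational.
\<close>
lemma diff_coeff_irrational:
  fixes a :: "('n::finite \<Rightarrow> nat) \<Rightarrow> real"
  assumes A: "finite A" and l0: "l0 \<in> A" "a l0 \<notin> \<rat>" "l0 i > 0" and t: "t > 0"
    and top: "\<And>l. l \<in> A \<Longrightarrow> total_degree l > total_degree l0 \<Longrightarrow> a l \<in> \<rat>"
  shows "(\<Sum>l\<in>A. a l * real (diff_coeff i t l (l0(i := l0 i - 1)))) \<notin> \<rat>"
proof
  let ?m = "l0(i := l0 i - 1)"
  assume rat: "(\<Sum>l\<in>A. a l * real (diff_coeff i t l ?m)) \<in> \<rat>"
  have "a l * real (diff_coeff i t l ?m) \<in> \<rat>" if l: "l \<in> A - {l0}" for l
  proof (cases "diff_coeff i t l ?m = 0")
    case False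
    hence eq: "?m = l(i := l0 i - 1)" and lt: "l0 i - 1 < l i"
      by (auto simp: diff_coeff_def split: if_splits)
    have "l0 = l" if "l0 i = l i"
    proof
      fix k show "l0 k = l k" using fun_cong[OF eq, of k] that by (cases "k = i") auto
    qed
    with l lt have "l0 i < l i" by fastforce
    moreover have "total_degree l0 + l i = total_degree l + l0 i"
      using total_degree_fun_upd[of l0 i "l0 i - 1"] total_degree_fun_upd[of l i "l0 i - 1"]
      unfolding eq by linarith
    ultimately show ?thesis using top l by (intro Rats_mult) auto
  qed simp
  hence "(\<Sum>l\<in>A - {l0}. a l * real (diff_coeff i t l ?m)) \<in> \<rat>"
    by (rule Rats_sum)
  moreover have "(\<Sum>l\<in>A. a l * real (diff_coeff i t l ?m)) =
      a l0 * real (l0 i * t) + (\<Sum>l\<in>A - {l0}. a l * real (diff_coeff i t l ?m))"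
  proof -
    have "diff_coeff i t l0 ?m = l0 i * t"
      using l0 by (cases "l0 i") (auto simp: diff_coeff_def)
    thus ?thesis by (simp only: sum.remove[OF A l0(1)])
  qed
  ultimately have "(a l0 * real (l0 i * t) + (\<Sum>l\<in>A - {l0}. a l * real (diff_coeff i t l ?m))) -
      (\<Sum>l\<in>A - {l0}. a l * real (diff_coeff i t l ?m)) \<in> \<rat>"
    using rat by (intro Rats_diff) auto
  hence "a l0 * real (l0 i * t) / real (l0 i * t) \<in> \<rat>" by (intro Rats_divide) auto
  with l0 t show False by simp
qed

section \<open>Weyl sums\<close>

lemma common_denominator:
  fixes a :: "'b \<Rightarrow> real"
  assumes "finite A" "\<And>l. l \<in> A \<Longrightarrow> a l \<in> \<rat>"
  shows "\<exists>q::nat. q > 0 \<and> (\<forall>l\<in>A. a l * real q \<in> \<int>)"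
  using assms
proof (induction rule: finite_induct)
  case (insert l A)
  then obtain q where q: "q > 0" "\<forall>l\<in>A. a l * real q \<in> \<int>" by auto
  have "a l \<in> \<rat>" using insert by simp
  then obtain r :: nat and p :: int where r: "r > 0" "a l = of_int p / of_nat r"
    by (auto simp: Rats_eq_int_div_nat)
  show ?case
  proof (intro exI[of _ "r * q"] conjI ballI)
    fix k assume "k \<in> insert l A"
    thus "a k * real (r * q) \<in> \<int>"
    proof
      assume "k = l"
      hence "a k * real (r * q) = of_int p * of_nat q" using r by simp
      thus ?thesis by (simp only: Ints_mult Ints_of_int Ints_of_nat)
    next
      assume "k \<in> A"
      hence "real r * (a k * real q) \<in> \<int>" using q by (intro Ints_mult[OF Ints_of_nat]) auto
      thus ?thesis by (simp add: mult_ac)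
    qed
  qed (use q r in auto)
qed auto

lemma cis_2pi_add_int: "n \<in> \<int> \<Longrightarrow> cis (2 * pi * (c + n)) = cis (2 * pi * c)"
  by (simp add: distrib_left cis_multiple_2pi flip: cis_mult)

lemma cis_2pi_eq_1_iff: "cis (2 * pi * c) = 1 \<longleftrightarrow> c \<in> \<int>"
proof
  assume "cis (2 * pi * c) = 1"
  hence "cos (2 * pi * c) = 1" by (simp add: complex_eq_iff)
  then obtain n :: int where "2 * pi * c = of_int n * 2 * pi" by (auto simp: cos_one_2pi_int)
  thus "c \<in> \<int>" by simp
qed (simp add: cis_multiple_2pi)

lemma multi_power_Ints: "x \<in> int_lattice \<Longrightarrow> multi_power x l \<in> \<int>"
  by (auto simp: multi_power_def int_lattice_def intro!: Ints_prod Ints_power)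

lemma norm_mod1 [simp]: "norm (mod1 F x) = 1"
  by (simp add: mod1_def)

text \<open>
  Induction on the largest degree \<open>k + 1\<close> of an exponent with irrational coefficient; the degree of
  the polynomial itself may be larger. Choose a coordinate \<open>i\<close> that occurs in such an exponent.

  If the degree is \<open>1\<close>, let \<open>q\<close> be a common denominator of all coefficients of degree
  greater than \<open>1\<close>. Translation by \<open>q e\<^sub>i\<close> changes the polynomial, modulo integers, by an irrational
  constant, so the exponential is an eigenfunction of this translation with eigenvalue other than \<open>1\<close>.

  If the degree is at least \<open>2\<close>, every difference by a positive step in direction \<open>i\<close> is a polynomial whose
  irrational coefficients reach exactly one degree less. The induction hypothesis applies to all
  these differences, and \<open>van_der_corput\<close> transfers the conclusion.
\<close>
lemma weyl_sum_tendsto_0: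
  fixes a :: "('n::finite \<Rightarrow> nat) \<Rightarrow> real"
  assumes "finite A" "l0 \<in> A" "a l0 \<notin> \<rat>" "total_degree l0 = Suc k"
    and "\<And>l. l \<in> A \<Longrightarrow> total_degree l > Suc k \<Longrightarrow> a l \<in> \<rat>"
  shows "((\<lambda>R. finite_mean (lattice_ball R) (mod1 (poly_sum A a))) \<longlongrightarrow> 0) at_top"
  using assms
proof (induction k arbitrary: A a l0)
  case (0 A a l0)
  obtain i where i: "l0 i > 0"
    using "0.prems"(4) by (metis bot_nat_0.not_eq_extremum sum.neutral zero_neq_one One_nat_def)
  have l0_lowered: "l0(i := l0 i - 1) = (\<lambda>_. 0)"
  proof -
    have "total_degree (l0(i := l0 i - 1)) = 0"
      using total_degree_fun_upd[of l0 i "l0 i - 1"] i 0 by simp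
    thus ?thesis by (simp add: fun_eq_iff)
  qed
  obtain q :: nat where q: "q > 0" "\<And>l. l \<in> A \<Longrightarrow> total_degree l > 1 \<Longrightarrow> a l * real q \<in> \<int>"
    using common_denominator[of "{l \<in> A. total_degree l > 1}" a] 0 by auto
  define b where "b m = (\<Sum>l\<in>A. a l * real (diff_coeff i q l m))" for m
  \<comment> \<open>the constant term of the difference, where the linear monomial \<open>l0\<close> goes\<close>
  have b0: "b (\<lambda>_. 0) \<notin> \<rat>"
    using diff_coeff_irrational[of A l0 a i q] 0 i q l0_lowered by (simp add: b_def)
  \<comment> \<open>only exponents of degree at least \<open>2\<close> contribute to \<open>b m\<close>, and \<open>q\<close> clears their coefficients\<close>
  have b_int: "b m \<in> \<int>" if "m \<noteq> (\<lambda>_. 0)" for m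
    unfolding b_def
  proof (rule Ints_sum)
    fix l assume l: "l \<in> A"
    show "a l * real (diff_coeff i q l m) \<in> \<int>"
    proof (cases "diff_coeff i q l m = 0")
      case False
      have "total_degree m > 0" using that by (intro Nat.gr0I) (simp add: fun_eq_iff)
      with diff_coeff_degree[OF False] q(2)[OF l] have "a l * real q \<in> \<int>" by simp
      moreover obtain r where "diff_coeff i q l m = q * r" using diff_coeff_dvd[of q i l m] by (elim dvdE)
      ultimately show ?thesis using Ints_mult[of "a l * real q" "real r"] by (simp add: mult.assoc)
    qed simp
  qed
  have diff: "poly_sum A a (x + real q *\<^sub>R axis i 1) - poly_sum A a x - b (\<lambda>_. 0) \<in> \<int>"
    if x: "x \<in> int_lattice" for x
  proof -
    let ?B = "lowered A i"
    have "(\<lambda>_. 0) \<in> ?B"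
      using 0 i l0_lowered[symmetric] by (auto simp: lowered_def intro!: bexI[of _ l0])
    hence "poly_sum ?B b x =
        b (\<lambda>_. 0) * multi_power x (\<lambda>_. 0) + (\<Sum>m\<in>?B - {\<lambda>_. 0}. b m * multi_power x m)"
      unfolding poly_sum_def using 0 by (intro sum.remove finite_lowered)
    moreover have "poly_sum A a (x + real q *\<^sub>R axis i 1) - poly_sum A a x = poly_sum ?B b x"
      unfolding b_def using 0 by (intro poly_sum_difference)
    moreover have "(\<Sum>m\<in>?B - {\<lambda>_. 0}. b m * multi_power x m) \<in> \<int>"
      using x by (intro Ints_sum Ints_mult b_int multi_power_Ints) auto
    ultimately show ?thesis by (simp add: multi_power_def)
  qed
  show ?case
  proof (rule lattice_mean_eigenfunction)
    show "real q *\<^sub>R axis i 1 \<in> int_lattice"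
      by (intro scaleR_in_int_lattice axis_in_int_lattice) auto
    show "mod1 (poly_sum A a) (x + real q *\<^sub>R axis i 1) =
        cis (2 * pi * b (\<lambda>_. 0)) * mod1 (poly_sum A a) x" if "x \<in> int_lattice" for x
      using cis_2pi_add_int[OF diff[OF that], of "b (\<lambda>_. 0) + poly_sum A a x"]
      by (simp add: mod1_def cis_mult algebra_simps)
    show "cis (2 * pi * b (\<lambda>_. 0)) \<noteq> 1"
      using b0 Ints_subset_Rats by (auto simp: cis_2pi_eq_1_iff)
  qed simp
next
  case (Suc k A a l0)
  obtain i where i: "l0 i > 0"
    using Suc.prems(4) by (metis bot_nat_0.not_eq_extremum sum.neutral nat.distinct(1))
  let ?m = "l0(i := l0 i - 1)"
  show ?case
  proof (rule van_der_corput[OF axis_in_int_lattice[of i]])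
    fix d :: nat assume d: "d > 0"
    define b where "b m = (\<Sum>l\<in>A. a l * real (diff_coeff i d l m))" for m
    have "((\<lambda>R. finite_mean (lattice_ball R) (mod1 (poly_sum (lowered A i) b))) \<longlongrightarrow> 0) at_top"
    proof (rule Suc.IH)
      show "finite (lowered A i)" using Suc.prems by (simp add: finite_lowered)
      show "?m \<in> lowered A i" using Suc.prems i by (auto simp: lowered_def intro!: bexI[of _ l0])
      show "b ?m \<notin> \<rat>"
        unfolding b_def using Suc.prems i d by (intro diff_coeff_irrational) auto
      show "total_degree ?m = Suc k"
        using total_degree_fun_upd[of l0 i "l0 i - 1"] Suc.prems(4) i by simp
      show "b m \<in> \<rat>" if "total_degree m > Suc k" for m
        unfolding b_def
      proof (rule Rats_sum)
        fix l assume "l \<in> A"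
        thus "a l * real (diff_coeff i d l m) \<in> \<rat>"
          using diff_coeff_degree[of i d l m] Suc.prems(5)[of l] that
          by (cases "diff_coeff i d l m = 0") (auto intro!: Rats_mult)
      qed
    qed
    moreover have "mod1 (poly_sum A a) (x + real d *\<^sub>R axis i 1) * cnj (mod1 (poly_sum A a) x) =
        mod1 (poly_sum (lowered A i) b) x" for x
      unfolding b_def poly_sum_difference[OF Suc.prems(1), symmetric]
      by (simp add: mod1_def cis_cnj cis_mult right_diff_distrib)
    ultimately show "((\<lambda>R. finite_mean (lattice_ball R) (\<lambda>x. mod1 (poly_sum A a) (x + real d *\<^sub>R axis i 1)
        * cnj (mod1 (poly_sum A a) x))) \<longlongrightarrow> 0) at_top"
      by simp
  qed simp
qed

section \<open>Weyl's criterion\<close>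

text \<open>
  The real functions that agree on the circle with a Laurent polynomial, in the form
  \<open>p(z) / z\<^sup>n\<close>: closure under sums and products is then inherited from polynomials.
\<close>
definition circle_laurent :: "(complex \<Rightarrow> real) \<Rightarrow> bool"
  where "circle_laurent g \<longleftrightarrow>
    (\<exists>n p. \<forall>z\<in>unit_circle. complex_of_real (g z) * z ^ n = poly p z)"

lemma circle_laurent_const: "circle_laurent (\<lambda>_. c)"
  unfolding circle_laurent_def by (intro exI[of _ "0 :: nat"] exI[of _ "[:of_real c:]"]) simp

lemma circle_laurent_add:
  assumes "circle_laurent f" "circle_laurent g" shows "circle_laurent (\<lambda>z. f z + g z)"
proof -
  obtain n p m q where "\<forall>z\<in>unit_circle. complex_of_real (f z) * z ^ n = poly p z"
    "\<forall>z\<in>unit_circle. complex_of_real (g z) * z ^ m = poly q z"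
    using assms by (auto simp: circle_laurent_def)
  thus ?thesis
    unfolding circle_laurent_def
    by (intro exI[of _ "n + m"] exI[of _ "p * monom 1 m + q * monom 1 n"])
       (auto simp: poly_monom power_add algebra_simps dest!: bspec)
qed

lemma circle_laurent_mult:
  assumes "circle_laurent f" "circle_laurent g" shows "circle_laurent (\<lambda>z. f z * g z)"
proof -
  obtain n p m q where pq: "\<forall>z\<in>unit_circle. complex_of_real (f z) * z ^ n = poly p z"
    "\<forall>z\<in>unit_circle. complex_of_real (g z) * z ^ m = poly q z"
    using assms by (auto simp: circle_laurent_def)
  show ?thesis
    unfolding circle_laurent_def
  proof (intro exI[of _ "n + m"] exI[of _ "p * q"] ballI)
    fix z :: complex assume "z \<in> unit_circle"
    hence "poly (p * q) z = (of_real (f z) * z ^ n) * (of_real (g z) * z ^ m)"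
      using pq by simp
    thus "complex_of_real (f z * g z) * z ^ (n + m) = poly (p * q) z"
      by (simp add: power_add mult_ac)
  qed
qed

lemma unit_circle_power_mult_cnj:
  "z \<in> unit_circle \<Longrightarrow> z ^ m * cnj z ^ m = 1"
  using complex_norm_square[of z] by (simp flip: power_mult_distrib)

text \<open>
  On the circle \<open>cnj z = 1 / z\<close>, so \<open>z Re z = (z\<^sup>2 + 1) / 2\<close> and
  \<open>z Im z = (z\<^sup>2 - 1) / (2 \<i>)\<close>.
\<close>
lemma circle_laurent_Re: "circle_laurent Re"
  unfolding circle_laurent_def
proof (intro exI[of _ "1 :: nat"] exI[of _ "[:1/2, 0, 1/2:]"] ballI)
  fix z :: complex assume "z \<in> unit_circle"
  hence "z * cnj z = 1" using complex_norm_square[of z] by simp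
  moreover have "complex_of_real (Re z) = (z + cnj z) / 2"
    by (simp add: complex_add_cnj)
  ultimately show "complex_of_real (Re z) * z ^ 1 = poly [:1/2, 0, 1/2:] z"
    by (simp add: algebra_simps add_divide_distrib)
qed

lemma circle_laurent_Im: "circle_laurent Im"
  unfolding circle_laurent_def
proof (intro exI[of _ "1 :: nat"] exI[of _ "[:\<i>/2, 0, -\<i>/2:]"] ballI)
  fix z :: complex assume "z \<in> unit_circle"
  hence "z * cnj z = 1" using complex_norm_square[of z] by simp
  moreover have Im: "complex_of_real (Im z) = (cnj z - z) * (\<i> / 2)"
    by (simp add: complex_eq_iff)
  ultimately show "complex_of_real (Im z) * z ^ 1 = poly [:\<i>/2, 0, -\<i>/2:] z"
    unfolding Im by (simp add: algebra_simps diff_divide_distrib)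
qed

text \<open>
  Stone--Weierstrass; the real and imaginary parts already separate the points of the circle.
\<close>
lemma circle_laurent_dense:
  fixes f :: "complex \<Rightarrow> real"
  assumes "continuous_on unit_circle f" "e > 0"
  obtains g where "circle_laurent g" "continuous_on unit_circle g"
    "\<And>z. z \<in> unit_circle \<Longrightarrow> \<bar>f z - g z\<bar> < e"
proof -
  have "\<exists>g. (circle_laurent g \<and> continuous_on unit_circle g) \<and> (\<forall>z\<in>unit_circle. \<bar>f z - g z\<bar> < e)"
  proof (rule Stone_Weierstrass_HOL)
    fix x y :: complex assume "x \<in> unit_circle \<and> y \<in> unit_circle \<and> x \<noteq> y"
    hence "Re x \<noteq> Re y \<or> Im x \<noteq> Im y" by (simp add: complex_eq_iff)
    moreover have "continuous_on unit_circle Re" "continuous_on unit_circle Im"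
      by (auto intro!: continuous_intros)
    moreover note circle_laurent_Re circle_laurent_Im
    ultimately show "\<exists>g. (circle_laurent g \<and> continuous_on unit_circle g) \<and> g x \<noteq> g y"
      by blast
  qed (use assms in \<open>auto intro: circle_laurent_const circle_laurent_add circle_laurent_mult continuous_intros\<close>)
  with that show ?thesis by blast
qed

lemma continuous_on_circle_measurable:
  fixes f :: "complex \<Rightarrow> 'b::{topological_space}"
  shows "continuous_on unit_circle f \<Longrightarrow> f \<in> borel_measurable circle_borel"
  by (rule borel_measurable_continuous_on_restrict)

lemma space_haar_circle: "space haar_circle = unit_circle"
  using sets_eq_imp_space_eq[OF sets_haar_circle] by (simp add: space_restrict_space)

lemma integrable_haar_circle:
  fixes f :: "complex \<Rightarrow> 'b::{banach, second_countable_topology}"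
  assumes "continuous_on unit_circle f"
  shows "integrable haar_circle f"
proof -
  interpret prob_space haar_circle by (rule prob_space_haar_circle)
  have "bounded (f ` unit_circle)"
    by (intro compact_imp_bounded compact_continuous_image assms) simp
  then obtain B where "\<And>z. z \<in> unit_circle \<Longrightarrow> norm (f z) \<le> B"
    unfolding bounded_iff by blast
  thus ?thesis
    using continuous_on_circle_measurable[OF assms]
    by (intro integrable_const_bound[where B = B])
       (auto simp: space_haar_circle measurable_cong_sets[OF sets_haar_circle refl] intro!: AE_I2)
qed

text \<open>
  Rotation invariance gives \<open>\<integral>f = c \<integral>f\<close>.
\<close>
lemma haar_integral_eq_0_of_rotation:
  fixes f :: "complex \<Rightarrow> complex"
  assumes f: "continuous_on unit_circle f" and w: "w \<in> unit_circle" "c \<noteq> 1"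
    and rot: "\<And>z. z \<in> unit_circle \<Longrightarrow> f (w * z) = c * f z"
  shows "integral\<^sup>L haar_circle f = 0"
proof -
  have "integral\<^sup>L haar_circle f = integral\<^sup>L (distr haar_circle circle_borel (\<lambda>z. w * z)) f"
    by (simp add: haar_circle_rotate[OF w(1)])
  also have "\<dots> = (\<integral>z. f (w * z) \<partial>haar_circle)"
    using measurable_rotate_circle[OF w(1)] continuous_on_circle_measurable[OF f]
    by (intro integral_distr) (auto simp: measurable_cong_sets[OF sets_haar_circle refl])
  also have "\<dots> = (\<integral>z. c * f z \<partial>haar_circle)"
    by (intro Bochner_Integration.integral_cong) (auto simp: rot space_haar_circle)
  also have "\<dots> = c * integral\<^sup>L haar_circle f" by simp
  finally show ?thesis using w(2) by simp
qed


lemma haar_integral_power: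
  assumes "j > 0"
  shows "(\<integral>z. z ^ j \<partial>haar_circle) = 0" "(\<integral>z. cnj z ^ j \<partial>haar_circle) = 0"
proof -
  \<comment> \<open>a rotation whose \<open>j\<close>-th power is the half turn\<close>
  let ?w = "cis (pi / real j)"
  have w: "?w ^ j = -1" using assms by (simp add: Complex.DeMoivre)
  have w': "cnj ?w ^ j = -1" by (metis w complex_cnj_power complex_cnj_minus complex_cnj_one)
  show "(\<integral>z. z ^ j \<partial>haar_circle) = 0"
    by (rule haar_integral_eq_0_of_rotation[where w = ?w and c = "-1"])
       (auto intro!: continuous_intros simp: power_mult_distrib w)
  show "(\<integral>z. cnj z ^ j \<partial>haar_circle) = 0"
    by (rule haar_integral_eq_0_of_rotation[where w = ?w and c = "-1"])
       (auto intro!: continuous_intros simp: power_mult_distrib w' simp del: cis_cnj)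
qed

text \<open>
  On the circle \<open>z\<^sup>k cnj(z)\<^sup>n\<close> is \<open>1\<close>, a positive power of \<open>z\<close>, or the conjugate of one. Conjugation
  commutes with means, which is why it suffices to control the positive powers.
\<close>
lemma tendsto_haar_laurent_monomial:
  assumes fin: "\<And>i. finite (S i)" and ne: "eventually (\<lambda>i. S i \<noteq> {}) \<F>"
    and unit: "\<And>x. h x \<in> unit_circle"
    and powers: "\<And>j :: nat. j > 0 \<Longrightarrow> ((\<lambda>i. finite_mean (S i) (\<lambda>x. h x ^ j)) \<longlongrightarrow> 0) \<F>"
  shows "((\<lambda>i. finite_mean (S i) (\<lambda>x. h x ^ k * cnj (h x) ^ n)) \<longlongrightarrow>
           (\<integral>z. z ^ k * cnj z ^ n \<partial>haar_circle)) \<F>"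
proof -
  interpret H: prob_space haar_circle by (rule prob_space_haar_circle)
  note cancel = unit_circle_power_mult_cnj
  show ?thesis
  proof (cases k n rule: linorder_cases)
    case less
    have eq: "z ^ k * cnj z ^ n = cnj z ^ (n - k)" if "z \<in> unit_circle" for z
    proof -
      have "cnj z ^ n = cnj z ^ k * cnj z ^ (n - k)" using less by (simp flip: power_add)
      thus ?thesis using cancel[OF that, of k] by (simp flip: mult.assoc)
    qed
    have "((\<lambda>i. cnj (finite_mean (S i) (\<lambda>x. h x ^ (n - k)))) \<longlongrightarrow> cnj 0) \<F>"
      using less by (intro tendsto_cnj powers) simp
    moreover have "(\<integral>z. z ^ k * cnj z ^ n \<partial>haar_circle) = (\<integral>z. cnj z ^ (n - k) \<partial>haar_circle)"
      by (intro Bochner_Integration.integral_cong) (auto simp: eq space_haar_circle)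
    ultimately show ?thesis
      using less haar_integral_power(2)[of "n - k"] by (simp add: eq[OF unit] flip: finite_mean_cnj)
  next
    case equal
    have "((\<lambda>i. finite_mean (S i) (\<lambda>_. 1)) \<longlongrightarrow> 1) \<F>"
      by (rule tendsto_eventually) (use ne in \<open>eventually_elim, simp add: fin finite_mean_const\<close>)
    moreover have "(\<integral>z. z ^ k * cnj z ^ k \<partial>haar_circle) = (\<integral>z. 1 \<partial>haar_circle)"
      by (intro Bochner_Integration.integral_cong) (auto simp: cancel space_haar_circle)
    ultimately show ?thesis using equal by (simp add: cancel[OF unit] H.prob_space)
  next
    case greater
    have eq: "z ^ k * cnj z ^ n = z ^ (k - n)" if "z \<in> unit_circle" for z
    proof -
      have "z ^ k = z ^ (k - n) * z ^ n" using greater by (simp flip: power_add)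
      thus ?thesis using cancel[OF that, of n] by (simp add: mult.assoc)
    qed
    have "(\<integral>z. z ^ k * cnj z ^ n \<partial>haar_circle) = (\<integral>z. z ^ (k - n) \<partial>haar_circle)"
      by (intro Bochner_Integration.integral_cong) (auto simp: eq space_haar_circle)
    thus ?thesis
      using greater haar_integral_power(1)[of "k - n"] powers[of "k - n"] by (simp add: eq[OF unit])
  qed
qed

lemma tendsto_haar_laurent:
  fixes g :: "complex \<Rightarrow> real" and h :: "'a \<Rightarrow> complex"
  assumes fin: "\<And>i. finite (S i)" and ne: "eventually (\<lambda>i. S i \<noteq> {}) \<F>"
    and unit: "\<And>x. h x \<in> unit_circle"
    and powers: "\<And>j :: nat. j > 0 \<Longrightarrow> ((\<lambda>i. finite_mean (S i) (\<lambda>x. h x ^ j)) \<longlongrightarrow> 0) \<F>"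
    and g: "circle_laurent g"
  shows "((\<lambda>i. (\<Sum>x\<in>S i. g (h x)) / real (card (S i))) \<longlongrightarrow> (\<integral>z. g z \<partial>haar_circle)) \<F>"
proof -
  obtain n p where p: "\<And>z. z \<in> unit_circle \<Longrightarrow> complex_of_real (g z) * z ^ n = poly p z"
    using g unfolding circle_laurent_def by blast
  have expand: "complex_of_real (g z) = (\<Sum>k\<le>degree p. coeff p k * (z ^ k * cnj z ^ n))"
    if z: "z \<in> unit_circle" for z
  proof -
    have "z ^ n * cnj z ^ n = 1"
      using z by (rule unit_circle_power_mult_cnj)
    hence "complex_of_real (g z) = poly p z * cnj z ^ n"
      using p[OF z, symmetric] by (simp add: mult.assoc)
    thus ?thesis by (simp add: poly_altdef sum_distrib_right mult.assoc)
  qed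
  have "((\<lambda>i. finite_mean (S i) (\<lambda>x. \<Sum>k\<le>degree p. coeff p k * (h x ^ k * cnj (h x) ^ n))) \<longlongrightarrow>
      (\<Sum>k\<le>degree p. coeff p k * (\<integral>z. z ^ k * cnj z ^ n \<partial>haar_circle))) \<F>"
    unfolding finite_mean_sum finite_mean_cmult
    by (intro tendsto_sum tendsto_mult_left tendsto_haar_laurent_monomial fin ne unit powers)
  moreover have "(\<Sum>k\<le>degree p. coeff p k * (\<integral>z. z ^ k * cnj z ^ n \<partial>haar_circle)) =
      (\<integral>z. (\<Sum>k\<le>degree p. coeff p k * (z ^ k * cnj z ^ n)) \<partial>haar_circle)"
    by (subst Bochner_Integration.integral_sum)
       (auto intro!: integrable_haar_circle continuous_intros)
  moreover have "\<dots> = (\<integral>z. complex_of_real (g z) \<partial>haar_circle)"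
    by (intro Bochner_Integration.integral_cong) (auto simp: expand space_haar_circle)
  moreover have "finite_mean (S i) (\<lambda>x. \<Sum>k\<le>degree p. coeff p k * (h x ^ k * cnj (h x) ^ n)) =
      complex_of_real ((\<Sum>x\<in>S i. g (h x)) / real (card (S i)))" for i
    unfolding expand[OF unit, symmetric] by (simp add: finite_mean_def)
  ultimately have "((\<lambda>i. complex_of_real ((\<Sum>x\<in>S i. g (h x)) / real (card (S i)))) \<longlongrightarrow>
      complex_of_real (\<integral>z. g z \<partial>haar_circle)) \<F>"
    by (simp only: integral_complex_of_real)
  thus ?thesis by (simp only: tendsto_of_real_iff)
qed

text \<open>
  Laurent polynomials in \<open>z\<close> converge in mean to their Haar integrals by linearity, and they are uniformly
  dense in the continuous functions on the circle.
\<close>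
lemma weyl_criterion:
  fixes F :: "real ^ 'n \<Rightarrow> real"
  assumes fin: "\<And>R. finite (\<Gamma> \<inter> ball 0 R \<inter> D)"
    and ne: "eventually (\<lambda>R. \<Gamma> \<inter> ball 0 R \<inter> D \<noteq> {}) at_top"
    and powers: "\<And>j :: nat. j > 0 \<Longrightarrow>
      ((\<lambda>R. finite_mean (\<Gamma> \<inter> ball 0 R \<inter> D) (mod1 (\<lambda>x. real j * F x))) \<longlongrightarrow> 0) at_top"
  shows "equidistributed_mod1 \<Gamma> D F"
  unfolding equidistributed_mod1_def weakly_converges_def
proof (intro allI impI)
  fix f :: "complex \<Rightarrow> real"
  assume "continuous_on unit_circle f \<and> bounded (f ` unit_circle)"
  hence f: "continuous_on unit_circle f" by simp
  let ?S = "\<lambda>R. \<Gamma> \<inter> ball 0 R \<inter> D"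
  let ?mean = "\<lambda>R f. (\<Sum>x\<in>?S R. f (mod1 F x)) / real (card (?S R))"
  interpret H: prob_space haar_circle by (rule prob_space_haar_circle)
  have unit: "mod1 F x \<in> unit_circle" for x by (simp add: mod1_def)
  have pow: "mod1 (\<lambda>x. real j * F x) = (\<lambda>x. mod1 F x ^ j)" for j
    by (simp add: fun_eq_iff mod1_def Complex.DeMoivre mult_ac)
  have integral: "integral\<^sup>L (distr (normalized_counting \<Gamma> D R) circle_borel (mod1 F)) f = ?mean R f" for R
  proof -
    have "mod1 F \<in> normalized_counting \<Gamma> D R \<rightarrow>\<^sub>M circle_borel"
      unfolding normalized_counting_def measurable_def
      by (auto simp: space_restrict_space space_uniform_count_measure sets_uniform_count_measure mod1_def)
    thus ?thesis
      using continuous_on_circle_measurable[OF f] fin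
      by (simp add: integral_distr normalized_counting_def integral_uniform_count_measure)
  qed
  show "((\<lambda>R. integral\<^sup>L (distr (normalized_counting \<Gamma> D R) circle_borel (mod1 F)) f) \<longlongrightarrow>
      integral\<^sup>L haar_circle f) at_top"
    unfolding integral
  proof (rule tendstoI)
    fix e :: real assume e: "e > 0"
    obtain g where g: "circle_laurent g" "continuous_on unit_circle g"
        "\<And>z. z \<in> unit_circle \<Longrightarrow> \<bar>f z - g z\<bar> < e / 3"
      using circle_laurent_dense[OF f, of "e / 3"] e by auto
    have "((\<lambda>R. ?mean R g) \<longlongrightarrow> integral\<^sup>L haar_circle g) at_top"
      using powers by (intro tendsto_haar_laurent fin ne unit g(1)) (simp add: pow)
    hence "eventually (\<lambda>R. dist (?mean R g) (integral\<^sup>L haar_circle g) < e / 3) at_top"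
      using e by (intro tendstoD) auto
    thus "eventually (\<lambda>R. dist (?mean R f) (integral\<^sup>L haar_circle f) < e) at_top"
      using ne
    proof eventually_elim
      case (elim R)
      have "card (?S R) > 0" using elim(2) fin[of R] by (simp add: card_gt_0_iff)
      have "\<bar>?mean R f - ?mean R g\<bar> = \<bar>\<Sum>x\<in>?S R. f (mod1 F x) - g (mod1 F x)\<bar> / real (card (?S R))"
        by (simp add: sum_subtractf flip: diff_divide_distrib)
      also have "\<dots> \<le> (real (card (?S R)) * (e / 3)) / real (card (?S R))"
        using g(3)[OF unit] by (intro divide_right_mono order_trans[OF sum_abs] sum_bounded_above)
             (auto intro: less_imp_le)
      also have "\<dots> = e / 3" using \<open>card (?S R) > 0\<close> by simp
      finally have 1: "\<bar>?mean R f - ?mean R g\<bar> \<le> e / 3" .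
      have "\<bar>integral\<^sup>L haar_circle f - integral\<^sup>L haar_circle g\<bar> = \<bar>\<integral>z. f z - g z \<partial>haar_circle\<bar>"
        by (simp add: Bochner_Integration.integral_diff integrable_haar_circle f g(2))
      also have "\<dots> \<le> (\<integral>z. \<bar>f z - g z\<bar> \<partial>haar_circle)"
        by (rule integral_abs_bound)
      also have "\<dots> \<le> (\<integral>z. e / 3 \<partial>haar_circle)"
        using g(3) by (intro integral_mono integrable_haar_circle continuous_intros f g(2))
                      (auto simp: space_haar_circle less_imp_le)
      also have "\<dots> = e / 3" by (simp add: H.prob_space)
      finally have 2: "\<bar>integral\<^sup>L haar_circle f - integral\<^sup>L haar_circle g\<bar> \<le> e / 3" .
      from 1 2 elim(1) show ?case unfolding dist_real_def by linarith
    qed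
  qed
qed

section \<open>Equidistribution of polynomials modulo 1\<close>

theorem theorem1p2:
  fixes \<alpha> :: "('n::finite \<Rightarrow> nat) \<Rightarrow> real"
    and F :: "real ^ 'n \<Rightarrow> real"
  assumes "finite {l. \<alpha> l \<noteq> 0}"
    and "\<And>x. F x = (\<Sum>l\<in>{l. \<alpha> l \<noteq> 0}. \<alpha> l * (\<Prod>i\<in>UNIV. (x $ i) ^ l i))"
    and "\<exists>l. (\<Sum>i\<in>UNIV. l i) > 0 \<and> \<alpha> l \<notin> \<rat>"
  shows "equidistributed_mod1 int_lattice UNIV F"
proof (rule weyl_criterion)
  show "finite (int_lattice \<inter> ball 0 R \<inter> UNIV :: (real ^ 'n) set)" for R by simp
  show "eventually (\<lambda>R. (int_lattice \<inter> ball 0 R \<inter> UNIV :: (real ^ 'n) set) \<noteq> {}) at_top"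
    using eventually_lattice_ball_nonempty by simp
  fix j :: nat assume j: "j > 0"
  let ?A = "{l. \<alpha> l \<noteq> 0}"
  \<comment> \<open>constant terms are excluded: an irrational constant cannot serve as \<open>l0\<close>\<close>
  let ?I = "{l. total_degree l > 0 \<and> \<alpha> l \<notin> \<rat>}"
  have "?I \<subseteq> ?A" by auto
  hence "finite ?I" using assms(1) by (rule finite_subset)
  moreover have "?I \<noteq> {}" using assms(3) by blast
  ultimately have "Max (total_degree ` ?I) \<in> total_degree ` ?I"
    by (intro Max_in) auto
  then obtain l0 where l0: "l0 \<in> ?I" "total_degree l0 = Max (total_degree ` ?I)"
    by (metis (lifting) imageE)
  have l0_max: "total_degree l \<le> total_degree l0" if "l \<in> ?I" for l
    unfolding l0(2) using \<open>finite ?I\<close> that by (intro Max_ge) auto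
  obtain k where k: "total_degree l0 = Suc k" using l0(1) by (auto dest: gr0_implies_Suc)
  have irrat: "real j * \<alpha> l \<in> \<rat> \<longleftrightarrow> \<alpha> l \<in> \<rat>" for l
  proof
    assume "real j * \<alpha> l \<in> \<rat>"
    hence "real j * \<alpha> l / real j \<in> \<rat>" by (intro Rats_divide) auto
    thus "\<alpha> l \<in> \<rat>" using j by simp
  qed auto
  have "((\<lambda>R. finite_mean (lattice_ball R) (mod1 (poly_sum ?A (\<lambda>l. real j * \<alpha> l)))) \<longlongrightarrow> 0) at_top"
  proof (rule weyl_sum_tendsto_0)
    show "finite ?A" by fact
    show "l0 \<in> ?A" using l0 \<open>?I \<subseteq> ?A\<close> by blast
    show "real j * \<alpha> l0 \<notin> \<rat>" using l0(1) by (simp add: irrat)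
    show "total_degree l0 = Suc k" by fact
    show "real j * \<alpha> l \<in> \<rat>" if "total_degree l > Suc k" for l
      unfolding irrat using l0_max[of l] that k by auto
  qed
  moreover have "poly_sum ?A (\<lambda>l. real j * \<alpha> l) = (\<lambda>x. real j * F x)"
    by (simp add: fun_eq_iff poly_sum_def multi_power_def assms(2) sum_distrib_left mult.assoc)
  ultimately show "((\<lambda>R. finite_mean (int_lattice \<inter> ball 0 R \<inter> UNIV) (mod1 (\<lambda>x. real j * F x)))
      \<longlongrightarrow> 0) at_top"
    by simp
qed

end
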